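(* Let $\theta=\frac{L}{2}-\beta_*$ and let $\varphi$ be a polynomial which maps the half-plane $\mathbb{C}_\theta$ into itself. Suppose that the composition operator $C_\varphi$ is bounded on $\mathcal{H}(\beta,\Lambda)$. Then: (1) If $\lambda_1>0$, then $\varphi(z)=az+b$ with $a\ge 1$ real and $b\in\mathbb{C}$. (2) If $\lambda_1=0$, then either $\varphi(z)=b$ with $b\in\mathbb{C}$ (that is, $a=0$), or $\varphi(z)=az+b$ with $a\geq 1$ real and $b\in\mathbb{C}$. Moreover, $a$ satisfies $\lambda_{m_k}=a\lambda_k$ for all $k\in\mathbb{N}$, where $m_k$ is the index of the first non-zero coefficient in the representation of $C_{\varphi}(e^{-\lambda_k z})=e^{-\lambda_k(az+b)}$ as a Dirichlet series $\sum_{n\ge1} c_n e^{-\lambda_n z}$ (i.e. the smallest $n$ with $c_n\neq 0$); and $b$ satisfies $\operatorname{Re}(b)>\frac{L}{2}-\beta_*$ if $a=0$, and $\operatorname{Re}(b)\geq(1-a)\left(\frac{L}{2}-\beta_*\right)$ if $a\geq1$.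
   Context: $\mathbb{N}=\{1,2,\dots\}$. $\Lambda=(\lambda_n)_{n\ge1}$ is a strictly increasing sequence of non-negative real numbers tending to $\infty$ with $L:=\limsup_{n\to\infty}\frac{\log n}{\lambda_n}<\infty$. $\beta=(\beta_n)_{n\ge1}$ is a sequence of positive real numbers with $\beta_*:=\liminf_{n\to\infty}\frac{\log\beta_n}{\lambda_n}\neq\pm\infty$. For $r\in\mathbb{R}$, $\mathbb{C}_r=\{z\in\mathbb{C}:\operatorname{Re}(z)>r\}$. $\mathcal{H}(\beta,\Lambda)$ is the space of Dirichlet series $f(z)=\sum_{n=1}^\infty a_ne^{-\lambda_nz}$ with $\sum_{n=1}^\infty|a_n|^2\beta_n^2<\infty$; such series converge to holomorphic functions on $\mathbb{C}_{L/2-\beta_*}$, their coefficients are uniquely determined by $f$, and $\mathcal{H}(\beta,\Lambda)$ is a Hilbert space with inner product $\langle f,g\rangle=\sum_{n}a_n\overline{b_n}\beta_n^2$ (for $f=\sum a_ne^{-\lambda_nz}$, $g=\sum b_ne^{-\lambda_nz}$). For a holomorphic self-map $\varphi$ of $\mathbb{C}_{L/2-\beta_*}$, $C_\varphi f=f\circ\varphi$; $C_\varphi$ is a bounded composition operator on $\mathcal{H}(\beta,\Lambda)$ if it maps $\mathcal{H}(\beta,\Lambda)$ into itself boundedly. *)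

theory Defs
  imports "HOL-Analysis.Analysis" "HOL-Computational_Algebra.Polynomial"
begin

text \<open>Sequences are indexed by the positive integers: their value at \<open>0\<close> is irrelevant
  and is never constrained or used (up to the finitely many terms a limit ignores).\<close>

definition growth_exponent :: "(nat \<Rightarrow> real) \<Rightarrow> ereal" where
  "growth_exponent lam = limsup (\<lambda>n. ereal (ln (real n) / lam n))"

definition weight_exponent :: "(nat \<Rightarrow> real) \<Rightarrow> (nat \<Rightarrow> real) \<Rightarrow> ereal" where
  "weight_exponent \<beta> lam = liminf (\<lambda>n. ereal (ln (\<beta> n) / lam n))"

text \<open>\<open>L / 2 - \<beta>\<^sub>*\<close>; meaningful only if both exponents are finite.\<close>

definition abscissa :: "(nat \<Rightarrow> real) \<Rightarrow> (nat \<Rightarrow> real) \<Rightarrow> real" where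
  "abscissa \<beta> lam =
     real_of_ereal (growth_exponent lam) / 2 - real_of_ereal (weight_exponent \<beta> lam)"

definition half_plane :: "real \<Rightarrow> complex set" where
  "half_plane r = {z. Re z > r}"

definition dirichlet_rep ::
    "(nat \<Rightarrow> real) \<Rightarrow> (nat \<Rightarrow> real) \<Rightarrow> (complex \<Rightarrow> complex) \<Rightarrow> (nat \<Rightarrow> complex) \<Rightarrow> bool" where
  "dirichlet_rep \<beta> lam f a \<longleftrightarrow>
     summable (\<lambda>n. (cmod (a (Suc n)))\<^sup>2 * (\<beta> (Suc n))\<^sup>2) \<and>
     (\<forall>z \<in> half_plane (abscissa \<beta> lam).
        (\<lambda>n. a (Suc n) * exp (- complex_of_real (lam (Suc n)) * z)) sums f z)"

text \<open>The space \<open>H(\<beta>, \<Lambda>)\<close>. Its elements are functions on the half-plane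
  \<open>Re z > L / 2 - \<beta>\<^sub>*\<close>; values of the total function \<open>f\<close> elsewhere are irrelevant.\<close>

definition dirichlet_space ::
    "(nat \<Rightarrow> real) \<Rightarrow> (nat \<Rightarrow> real) \<Rightarrow> (complex \<Rightarrow> complex) set" where
  "dirichlet_space \<beta> lam = {f. \<exists>a. dirichlet_rep \<beta> lam f a}"

text \<open>The coefficients of an element of the space are unique at all indices \<open>n \<ge> 1\<close>, so the
  choice only affects the unused value at \<open>0\<close>.\<close>

definition dirichlet_coeff ::
    "(nat \<Rightarrow> real) \<Rightarrow> (nat \<Rightarrow> real) \<Rightarrow> (complex \<Rightarrow> complex) \<Rightarrow> nat \<Rightarrow> complex" where
  "dirichlet_coeff \<beta> lam f = (SOME a. dirichlet_rep \<beta> lam f a)"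

definition dirichlet_norm ::
    "(nat \<Rightarrow> real) \<Rightarrow> (nat \<Rightarrow> real) \<Rightarrow> (complex \<Rightarrow> complex) \<Rightarrow> real" where
  "dirichlet_norm \<beta> lam f =
     sqrt (\<Sum>n. (cmod (dirichlet_coeff \<beta> lam f (Suc n)))\<^sup>2 * (\<beta> (Suc n))\<^sup>2)"

definition comp_op :: "(complex \<Rightarrow> complex) \<Rightarrow> (complex \<Rightarrow> complex) \<Rightarrow> complex \<Rightarrow> complex" where
  "comp_op \<phi> f = f \<circ> \<phi>"

definition bounded_comp_op ::
    "(nat \<Rightarrow> real) \<Rightarrow> (nat \<Rightarrow> real) \<Rightarrow> (complex \<Rightarrow> complex) \<Rightarrow> bool" where
  "bounded_comp_op \<beta> lam \<phi> \<longleftrightarrow>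
     (\<forall>f \<in> dirichlet_space \<beta> lam. comp_op \<phi> f \<in> dirichlet_space \<beta> lam) \<and>
     (\<exists>C. \<forall>f \<in> dirichlet_space \<beta> lam.
        dirichlet_norm \<beta> lam (comp_op \<phi> f) \<le> C * dirichlet_norm \<beta> lam f)"

end

theory Submission
  imports Defs
begin

text \<open>
  Two independent facts carry the theorem.

  The first is geometric. Near infinity a polynomial of degree \<open>d \<ge> 1\<close> looks like its leading term
  \<open>c z\<^sup>d\<close>, which multiplies arguments by \<open>d\<close> and rotates them by \<open>arg c\<close>. A right half-plane fills
  an angle of exactly \<open>\<pi>\<close>, so it cannot be mapped into another right half-plane if \<open>d \<ge> 2\<close> (the
  asymptotic directions of the image omit at most one point of the circle), and for \<open>d = 1\<close> the
  rotation must be trivial, that is \<open>c > 0\<close> (\<open>poly_between_half_planes_affine\<close>). Constants being the case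
  \<open>a = 0\<close>, this gives \<open>\<phi>(z) = a z + b\<close> with \<open>a \<ge> 0\<close>, and the bound on
  \<open>Re b\<close> is read off at the boundary of the half-plane.

  The second is asymptotic. The condition \<open>L < \<infinity>\<close> makes a Dirichlet series that converges somewhere
  converge absolutely far to the right, where it is equivalent to its first non-zero term
  \<open>c\<^sub>m exp (- \<lambda>\<^sub>m s)\<close> (\<open>dirichlet_series_leading_term\<close>). The operator sends the element
  \<open>exp (- \<lambda>\<^sub>k z)\<close> of the space to \<open>exp (- \<lambda>\<^sub>k b) exp (- a \<lambda>\<^sub>k z)\<close>; comparing decay rates as \<open>z\<close> tends to
  infinity along the reals gives \<open>\<lambda>\<^sub>m = a \<lambda>\<^sub>k\<close> (\<open>exponential_leading_exponent\<close>).

  Hence multiplication by \<open>a\<close> maps the set of frequencies into itself. It cannot lower the least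
  positive frequency to a smaller positive one, which excludes \<open>0 < a < 1\<close>, and \<open>a = 0\<close> requires that
  \<open>0\<close> is a frequency, that is \<open>\<lambda>\<^sub>1 = 0\<close>.
\<close>

section \<open>Polynomials between half-planes\<close>

text \<open>Reversing the coefficients turns the behaviour at infinity into continuity at \<open>0\<close>:
  \<open>p(w) / w\<^sup>d\<close> is the reflected polynomial at \<open>1 / w\<close>, and its value at \<open>0\<close> is the leading coefficient.\<close>

lemma poly_scaled_tendsto_lead_coeff:
  fixes p :: "complex poly" and u :: complex
  assumes "u \<noteq> 0"
  shows "((\<lambda>r. poly p (of_real r * u) / of_real r ^ degree p) \<longlongrightarrow> lead_coeff p * u ^ degree p) at_top"
proof -
  have lim0: "((\<lambda>r. inverse (complex_of_real r * u)) \<longlongrightarrow> 0) at_top"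
  proof -
    have "((\<lambda>r. complex_of_real (inverse r) * inverse u) \<longlongrightarrow> complex_of_real 0 * inverse u) at_top"
      by (intro tendsto_intros tendsto_inverse_0_at_top filterlim_ident)
    then show ?thesis by (simp add: field_simps)
  qed
  have "((\<lambda>r. poly (reflect_poly p) (inverse (complex_of_real r * u)) * u ^ degree p)
      \<longlongrightarrow> poly (reflect_poly p) 0 * u ^ degree p) at_top"
    by (intro tendsto_intros lim0)
  moreover have "eventually (\<lambda>r. poly (reflect_poly p) (inverse (complex_of_real r * u)) * u ^ degree p
      = poly p (of_real r * u) / of_real r ^ degree p) at_top"
    using eventually_gt_at_top[of 0]
  proof eventually_elim
    case (elim r)
    then show ?case using assms
      by (simp add: poly_reflect_poly_nz field_simps power_mult_distrib)
  qed
  ultimately show ?thesis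
    by (simp add: poly_0_coeff_0 filterlim_cong)
qed

text \<open>The bound \<open>Re (p z) > \<theta>'\<close>, divided by \<open>r\<^sup>d\<close>, survives in the limit \<open>r \<longlongrightarrow> \<infinity>\<close> along each ray
  into the half-plane. Moving the half-plane to the imaginary axis changes neither the degree nor the
  leading coefficient.\<close>

lemma Re_lead_coeff_nonneg_of_half_planes:
  fixes p :: "complex poly"
  assumes maps: "poly p ` half_plane \<theta> \<subseteq> half_plane \<theta>'" and deg: "degree p \<ge> 1" and u: "Re u > 0"
  shows "Re (lead_coeff p * u ^ degree p) \<ge> 0"
proof -
  define q where "q = pcompose p [:complex_of_real \<theta>, 1:]"
  have q: "degree q = degree p" "lead_coeff q = lead_coeff p"
    using lead_coeff_comp[of "[:complex_of_real \<theta>, 1:]" p] by (simp_all add: q_def degree_pcompose)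
  have "u \<noteq> 0" using u by auto
  from poly_scaled_tendsto_lead_coeff[OF this, of q, unfolded q(2), unfolded q(1)]
  have lim: "((\<lambda>r. Re (poly q (of_real r * u) / of_real r ^ degree p))
      \<longlongrightarrow> Re (lead_coeff p * u ^ degree p)) at_top"
    by (rule tendsto_Re)
  have lim0: "((\<lambda>r::real. \<theta>' / r ^ degree p) \<longlongrightarrow> 0) at_top"
    using deg by (intro real_tendsto_divide_at_top tendsto_const filterlim_pow_at_top filterlim_ident) auto
  have "eventually (\<lambda>r. \<theta>' / r ^ degree p \<le> Re (poly q (of_real r * u) / of_real r ^ degree p)) at_top"
    using eventually_gt_at_top[of 0]
  proof eventually_elim
    case (elim r)
    then have "complex_of_real \<theta> + of_real r * u \<in> half_plane \<theta>"
      using u by (simp add: half_plane_def)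
    then have "Re (poly p (complex_of_real \<theta> + of_real r * u)) > \<theta>'"
      using maps by (auto simp: half_plane_def image_subset_iff)
    then have "Re (poly q (of_real r * u)) > \<theta>'"
      by (simp add: q_def poly_pcompose add.commute)
    moreover have "Re (poly q (of_real r * u) / of_real r ^ degree p)
        = Re (poly q (of_real r * u)) / r ^ degree p"
      by (simp flip: of_real_power)
    ultimately show ?case using elim by (simp add: divide_right_mono)
  qed
  from tendsto_le[OF _ lim lim0 this] show ?thesis by simp
qed

text \<open>The principal \<open>d\<close>-th root has argument in \<open>(- \<pi> / d, \<pi> / d)\<close>, so for \<open>d \<ge> 2\<close> the \<open>d\<close>-th powers of
  the right half-plane already cover the plane slit along the non-positive reals.\<close>

lemma power_right_half_plane_covers_slit_plane:
  fixes w :: complex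
  assumes d: "d \<ge> 2" and w: "w \<notin> \<real>\<^sub>\<le>\<^sub>0"
  obtains u where "Re u > 0" "u ^ d = w"
proof
  let ?u = "exp (Ln w / of_nat d)"
  have w0: "w \<noteq> 0" using w by auto
  have "\<bar>Im (Ln w)\<bar> < pi"
    using w0 mpi_less_Im_Ln[OF w0] Im_Ln_le_pi[OF w0] w Im_Ln_eq_pi[OF w0]
    by (auto simp: abs_if complex_nonpos_Reals_iff less_le)
  moreover have "pi * 2 \<le> pi * real d" using d by simp
  ultimately have "\<bar>Im (Ln w)\<bar> * 2 < pi * real d" by linarith
  then have "\<bar>Im (Ln w)\<bar> / real d < pi / 2" using d by (simp add: field_simps)
  then have "\<bar>Im (Ln w) / real d\<bar> < pi / 2" by (simp add: abs_divide)
  then have "cos (Im (Ln w) / real d) > 0" by (intro cos_gt_zero_pi) linarith+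
  then show "Re ?u > 0" by (simp add: Re_exp)
  have "?u ^ d = exp (of_nat d * (Ln w / of_nat d))" by (rule exp_of_nat_mult[symmetric])
  also have "\<dots> = w" using d w0 by simp
  finally show "?u ^ d = w" .
qed

text \<open>Only the leading coefficient \<open>c\<close> and the degree matter: \<open>c u\<^sup>d\<close> must have non-negative real part for
  all \<open>u\<close> in the right half-plane. For \<open>d \<ge> 2\<close> the powers \<open>u\<^sup>d\<close> include a direction that \<open>c\<close> turns to the
  left; for \<open>d = 1\<close> the vertical line through \<open>1\<close> forces \<open>c\<close> to be real.\<close>

theorem poly_between_half_planes_affine:
  fixes p :: "complex poly"
  assumes maps: "poly p ` half_plane \<theta> \<subseteq> half_plane \<theta>'"
  obtains a :: real and b :: complex
  where "a \<ge> 0" "\<And>z. poly p z = complex_of_real a * z + b"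
proof -
  define c where "c = lead_coeff p"
  have sgn: "Re (c * u ^ degree p) \<ge> 0" if "Re u > 0" "degree p \<ge> 1" for u
    unfolding c_def using Re_lead_coeff_nonneg_of_half_planes[OF maps] that by blast
  consider "degree p = 0" | "degree p = 1" | "degree p \<ge> 2" by linarith
  then show ?thesis
  proof cases
    case 1
    then obtain b where "p = [:b:]" by (metis degree_eq_zeroE)
    then show ?thesis using that[of 0 b] by simp
  next
    case 2
    then have p: "poly p z = c * z + coeff p 0" for z
      by (simp add: poly_altdef c_def)
    have nonneg: "Re c - t * Im c \<ge> 0" for t
      using sgn[of "Complex 1 t"] 2 by (simp add: mult.commute)
    have "Im c = 0"
    proof (rule ccontr)
      assume "Im c \<noteq> 0"
      \<comment> \<open>The point \<open>1 + i t\<close> is taken so far along the vertical line that the rotated image crosses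
        the imaginary axis.\<close>
      then show False using nonneg[of "(Re c + 1) / Im c"] by simp
    qed
    moreover have "Re c \<ge> 0" using nonneg[of 0] by simp
    ultimately have "c = complex_of_real (Re c)" by (simp add: complex_eq_iff)
    then show ?thesis using that[of "Re c" "coeff p 0"] p \<open>Re c \<ge> 0\<close> by metis
  next
    case 3
    then have c0: "c \<noteq> 0" by (auto simp: c_def)
    \<comment> \<open>The direction \<open>- cnj c\<close> sends \<open>c w\<close> to the negative axis; it lies on the slit exactly when
      \<open>c > 0\<close>, and then a direction at an angle of \<open>\<pi> / 4\<close> from the slit serves.\<close>
    obtain w where w: "w \<notin> \<real>\<^sub>\<le>\<^sub>0" "Re (c * w) < 0"
    proof (cases "- cnj c \<in> \<real>\<^sub>\<le>\<^sub>0")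
      case True
      then have "Im c = 0" "Re c > 0"
        using c0 by (auto simp: complex_nonpos_Reals_iff complex_eq_iff)
      then show ?thesis
        by (intro that[of "Complex (- 1) 1"]) (auto simp: complex_nonpos_Reals_iff)
    next
      case False
      have "Re c * Re c + Im c * Im c > 0"
        using c0 by (simp add: complex_eq_iff sum_squares_gt_zero_iff)
      then show ?thesis using False by (intro that[of "- cnj c"]) auto
    qed
    obtain u where "Re u > 0" "u ^ degree p = w"
      using power_right_half_plane_covers_slit_plane[OF 3 w(1)] by blast
    then show ?thesis using sgn[of u] 3 w(2) by auto
  qed
qed

section \<open>Leading terms of general Dirichlet series\<close>

text \<open>If \<open>K\<close> exceeds \<open>L\<close> then eventually \<open>\<lambda>\<^sub>n > ln n / K\<close>, so at \<open>2 K\<close> the exponentials are dominated by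
  \<open>1 / n\<^sup>2\<close>.\<close>

lemma summable_exp_of_growth_exponent_finite:
  assumes lim: "filterlim lam at_top sequentially" and fin: "growth_exponent lam < \<infinity>"
  obtains T :: real where "summable (\<lambda>n. exp (- lam n * T))"
proof -
  obtain K0 :: real where "growth_exponent lam < ereal K0"
    using fin ereal_dense2 by blast
  moreover define K where "K = max K0 1"
  ultimately have K: "growth_exponent lam < ereal K" "K > 0"
    by (auto simp: less_max_iff_disj elim: less_le_trans)
  have ev: "eventually (\<lambda>n. ereal (ln (real n) / lam n) < ereal K) sequentially"
    using K(1) unfolding growth_exponent_def by (rule Limsup_lessD)
  have pos: "eventually (\<lambda>n. lam n > 0) sequentially"
    using lim by (auto simp: filterlim_at_top_dense)
  have "eventually (\<lambda>n. norm (exp (- lam n * (2 * K))) \<le> 1 / real n ^ 2) sequentially"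
    using ev pos eventually_gt_at_top[of 0]
  proof eventually_elim
    case (elim n)
    then have "ln (real n) < K * lam n" by (simp add: field_simps)
    then have "exp (- lam n * (2 * K)) \<le> exp (- (2 * ln (real n)))" by (simp add: mult.commute)
    also have "\<dots> = 1 / real n ^ 2"
      using elim by (simp add: exp_minus exp_double field_simps)
    finally show ?case by simp
  qed
  moreover have "summable (\<lambda>n. 1 / real n ^ 2)"
    using inverse_power_summable[of 2, where 'a = real] by (simp add: field_simps)
  ultimately show ?thesis by (rule that[OF summable_comparison_test_ev])
qed

text \<open>The terms of the series are bounded at one point, so after a shift by \<open>T\<close>, at \<open>s\<^sub>1\<close>, the series
  converges absolutely. Beyond \<open>s\<^sub>1\<close> every term after the \<open>m\<close>-th, relative to \<open>exp (- l\<^sub>m s)\<close>, shrinks by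
  at least a factor \<open>exp (- \<delta> (s - s\<^sub>1))\<close>, where \<open>\<delta>\<close> is the gap to the next frequency; hence so
  does their sum.\<close>

theorem dirichlet_series_leading_term:
  fixes l :: "nat \<Rightarrow> real" and c :: "nat \<Rightarrow> complex" and f :: "real \<Rightarrow> complex"
  assumes l: "strict_mono l"
    and T: "summable (\<lambda>n. exp (- l n * T))"
    and f: "\<And>s. s > \<sigma> \<Longrightarrow> (\<lambda>n. c n * of_real (exp (- l n * s))) sums f s"
    and zero: "\<And>n. n < m \<Longrightarrow> c n = 0"
  shows "((\<lambda>s. of_real (exp (l m * s)) * f s) \<longlongrightarrow> c m) at_top"
proof -
  define s0 where "s0 = \<sigma> + 1"
  define s1 where "s1 = s0 + T"
  define \<delta> where "\<delta> = l (Suc m) - l m"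
  have \<delta>: "\<delta> > 0" using l by (simp add: \<delta>_def strict_mono_Suc_iff)
  have "Bseq (\<lambda>n. c n * of_real (exp (- l n * s0)))"
    using f[of s0] by (intro convergent_imp_Bseq) (auto simp: s0_def convergent_def dest!: sums_summable summable_LIMSEQ_zero)
  then obtain M where M: "\<And>n. norm (c n * of_real (exp (- l n * s0))) \<le> M"
    unfolding Bseq_def by blast
  have abs_s1: "summable (\<lambda>n. norm (c n) * exp (- l n * s1))"
  proof (rule summable_comparison_test')
    show "summable (\<lambda>n. M * exp (- l n * T))" using T by (rule summable_mult)
    show "norm (norm (c n) * exp (- l n * s1)) \<le> M * exp (- l n * T)" if "n \<ge> 0" for n
    proof -
      have "norm (c n) * exp (- l n * s1) = norm (c n * of_real (exp (- l n * s0))) * exp (- l n * T)"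
        by (simp add: s1_def norm_mult algebra_simps exp_add[symmetric] del: of_real_exp)
      also have "\<dots> \<le> M * exp (- l n * T)" using M by (intro mult_right_mono) auto
      finally show ?thesis by simp
    qed
  qed
  define g where "g n s = norm (c (n + Suc m)) * exp (- (l (n + Suc m) - l m) * s)" for n s
  have g_sum: "summable (\<lambda>n. g n s1)"
  proof -
    have "summable (\<lambda>n. exp (l m * s1) * (norm (c (n + Suc m)) * exp (- l (n + Suc m) * s1)))"
      using abs_s1 by (intro summable_mult) (rule summable_ignore_initial_segment)
    moreover have "exp (l m * s1) * (norm (c (n + Suc m)) * exp (- l (n + Suc m) * s1)) = g n s1" for n
    proof -
      have "exp (l m * s1) * exp (- l (n + Suc m) * s1) = exp (- (l (n + Suc m) - l m) * s1)"
        unfolding exp_add[symmetric] by (simp add: algebra_simps)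
      then show ?thesis unfolding g_def by (metis mult.left_commute)
    qed
    ultimately show ?thesis by (simp only:)
  qed
  have g_le: "g n s \<le> exp (- \<delta> * (s - s1)) * g n s1" if "s \<ge> s1" for n s
  proof -
    have "l (Suc m) \<le> l (n + Suc m)" using l by (simp add: strict_mono_less_eq)
    then have "\<delta> * (s - s1) \<le> (l (n + Suc m) - l m) * (s - s1)"
      using that unfolding \<delta>_def by (intro mult_right_mono) auto
    then have "exp (- (l (n + Suc m) - l m) * s)
        \<le> exp (- \<delta> * (s - s1) + - (l (n + Suc m) - l m) * s1)"
      by (simp add: algebra_simps)
    then show ?thesis unfolding g_def exp_add
      by (metis (no_types, lifting) mult.left_commute mult_left_mono norm_ge_zero)
  qed
  have bound: "norm (of_real (exp (l m * s)) * f s - c m) \<le> exp (- \<delta> * (s - s1)) * (\<Sum>n. g n s1)"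
    if s: "s > \<sigma>" "s \<ge> s1" for s
  proof -
    let ?h = "\<lambda>n. of_real (exp (l m * s)) * (c n * of_real (exp (- l n * s)))"
    have "?h sums (of_real (exp (l m * s)) * f s)" using f[OF s(1)] by (rule sums_mult)
    then have "(\<lambda>n. ?h (n + Suc m)) sums (of_real (exp (l m * s)) * f s - (\<Sum>n<Suc m. ?h n))"
      by (rule sums_split_initial_segment)
    moreover have "(\<Sum>n<Suc m. ?h n) = c m"
      using zero by (simp add: exp_add[symmetric] flip: of_real_mult of_real_exp)
    ultimately have sums: "(\<lambda>n. ?h (n + Suc m)) sums (of_real (exp (l m * s)) * f s - c m)"
      by simp
    have h_le: "norm (?h (n + Suc m)) \<le> exp (- \<delta> * (s - s1)) * g n s1" for n
    proof -
      have "norm (?h (n + Suc m)) = g n s"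
        by (simp add: g_def norm_mult algebra_simps exp_add[symmetric] del: of_real_exp)
      then show ?thesis using g_le[OF s(2)] by simp
    qed
    have major: "summable (\<lambda>n. exp (- \<delta> * (s - s1)) * g n s1)"
      using g_sum by (rule summable_mult)
    have "norm (\<Sum>n. ?h (n + Suc m)) \<le> (\<Sum>n. exp (- \<delta> * (s - s1)) * g n s1)"
      using h_le major by (rule norm_suminf_le)
    then show ?thesis using sums_unique[OF sums] suminf_mult[OF g_sum] by simp
  qed
  have "((\<lambda>s. exp (- \<delta> * (s - s1)) * (\<Sum>n. g n s1)) \<longlongrightarrow> 0) at_top"
  proof -
    have "filterlim (\<lambda>s. - \<delta> * (s - s1)) at_bot at_top"
      unfolding filterlim_at_bot
    proof
      fix Z
      show "eventually (\<lambda>s. - \<delta> * (s - s1) \<le> Z) at_top"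
        using eventually_ge_at_top[of "s1 - Z / \<delta>"]
        by eventually_elim (use \<delta> in \<open>simp add: field_simps\<close>)
    qed
    then have "((\<lambda>s. exp (- \<delta> * (s - s1))) \<longlongrightarrow> 0) at_top"
      by (rule filterlim_compose[OF exp_at_bot])
    then show ?thesis by (rule tendsto_mult_left_zero)
  qed
  moreover have "eventually (\<lambda>s. norm (of_real (exp (l m * s)) * f s - c m)
      \<le> exp (- \<delta> * (s - s1)) * (\<Sum>n. g n s1)) at_top"
    using eventually_gt_at_top[of \<sigma>] eventually_ge_at_top[of s1]
    by eventually_elim (rule bound)
  ultimately have "((\<lambda>s. of_real (exp (l m * s)) * f s - c m) \<longlongrightarrow> 0) at_top"
    by (rule Lim_null_comparison[rotated])
  then show ?thesis by (rule LIM_zero_cancel)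
qed

text \<open>The shift \<open>s \<mapsto> s + 1\<close> multiplies the function by \<open>exp d\<close> but leaves the limit unchanged, so
  \<open>exp d = 1\<close>.\<close>

lemma exp_rate_zero_of_nonzero_limit:
  fixes d K L :: real
  assumes lim: "((\<lambda>s. K * exp (d * s)) \<longlongrightarrow> L) at_top" and "L \<noteq> 0"
  shows "d = 0"
proof -
  have "((\<lambda>s. K * exp (d * (s + 1))) \<longlongrightarrow> L) at_top"
    by (rule filterlim_compose[OF lim])
      (rule filterlim_at_top_mono[OF filterlim_ident], simp add: eventually_at_top_linorder)
  moreover have "((\<lambda>s. exp d * (K * exp (d * s))) \<longlongrightarrow> exp d * L) at_top"
    by (intro tendsto_intros lim)
  ultimately have "exp d * L = L"
    by (intro tendsto_unique[of at_top "\<lambda>s. K * exp (d * (s + 1))"]) (auto simp: algebra_simps exp_add)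
  then show ?thesis using \<open>L \<noteq> 0\<close> by simp
qed

section \<open>Frequencies of the image of an exponential\<close>

lemma exponential_in_dirichlet_space:
  assumes "k \<ge> 1"
  shows "(\<lambda>z. exp (- complex_of_real (lam k) * z)) \<in> dirichlet_space \<beta> lam"
proof -
  define e :: "nat \<Rightarrow> complex" where "e n = (if n = k then 1 else 0)" for n
  have "dirichlet_rep \<beta> lam (\<lambda>z. exp (- complex_of_real (lam k) * z)) e"
    unfolding dirichlet_rep_def
  proof (intro conjI ballI)
    show "summable (\<lambda>n. (cmod (e (Suc n)))\<^sup>2 * (\<beta> (Suc n))\<^sup>2)"
      by (rule summable_finite[of "{k - 1}"]) (use assms in \<open>auto simp: e_def\<close>)
    fix z
    have "(\<lambda>n. e (Suc n) * exp (- complex_of_real (lam (Suc n)) * z))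
        sums (\<Sum>n\<in>{k - 1}. e (Suc n) * exp (- complex_of_real (lam (Suc n)) * z))"
      by (rule sums_finite) (use assms in \<open>auto simp: e_def\<close>)
    then show "(\<lambda>n. e (Suc n) * exp (- complex_of_real (lam (Suc n)) * z))
        sums exp (- complex_of_real (lam k) * z)"
      using assms by (simp add: e_def)
  qed
  then show ?thesis by (auto simp: dirichlet_space_def)
qed

lemma dirichlet_rep_dirichlet_coeff:
  assumes "f \<in> dirichlet_space \<beta> lam"
  shows "dirichlet_rep \<beta> lam f (dirichlet_coeff \<beta> lam f)"
  using assms someI_ex[of "dirichlet_rep \<beta> lam f"]
  by (simp add: dirichlet_space_def dirichlet_coeff_def)

text \<open>By the leading term, \<open>\<kappa> exp (- \<mu> s)\<close> decays exactly as fast as \<open>exp (- \<lambda>\<^sub>m s)\<close>, where \<open>m\<close> is the first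
  index with a non-zero coefficient.\<close>

lemma exponential_leading_exponent:
  fixes lam :: "nat \<Rightarrow> real" and \<kappa> :: complex and \<mu> :: real
  assumes strict: "strict_mono_on {1..} lam"
    and lim: "filterlim lam at_top sequentially"
    and fin: "growth_exponent lam < \<infinity>"
    and rep: "dirichlet_rep \<beta> lam (\<lambda>z. \<kappa> * exp (- complex_of_real \<mu> * z)) c"
    and \<kappa>: "\<kappa> \<noteq> 0"
  obtains m where "m \<ge> 1" "c m \<noteq> 0" "\<And>n. 1 \<le> n \<Longrightarrow> n < m \<Longrightarrow> c n = 0" "lam m = \<mu>"
proof -
  define \<theta> where "\<theta> = abscissa \<beta> lam"
  have series: "(\<lambda>n. c (Suc n) * of_real (exp (- lam (Suc n) * s)))
      sums (\<kappa> * of_real (exp (- \<mu> * s)))" if "s > \<theta>" for s :: real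
    using rep that unfolding dirichlet_rep_def half_plane_def \<theta>_def
    by (auto dest!: bspec[of _ _ "complex_of_real s"] simp flip: exp_of_real)
  have "\<exists>n. c (Suc n) \<noteq> 0"
  proof (rule ccontr)
    assume "\<not> (\<exists>n. c (Suc n) \<noteq> 0)"
    then have "(\<lambda>n. 0) sums (\<kappa> * of_real (exp (- \<mu> * (\<theta> + 1))))"
      using series[of "\<theta> + 1"] by simp
    then show False using \<kappa> by (simp add: sums_iff)
  qed
  then obtain m where m: "c (Suc m) \<noteq> 0" and zero: "\<And>n. n < m \<Longrightarrow> c (Suc n) = 0"
    using exists_least_iff[of "\<lambda>n. c (Suc n) \<noteq> 0"] by blast
  obtain T where "summable (\<lambda>n. exp (- lam n * T))"
    using summable_exp_of_growth_exponent_finite[OF lim fin] by blast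
  then have T: "summable (\<lambda>n. exp (- lam (Suc n) * T))"
    by (subst summable_Suc_iff)
  have "strict_mono (\<lambda>n. lam (Suc n))"
    using strict by (auto simp: strict_mono_on_def intro!: strict_monoI)
  from dirichlet_series_leading_term[where c = "\<lambda>n. c (Suc n)", OF this T series zero]
  have "((\<lambda>s. norm (of_real (exp (lam (Suc m) * s)) * (\<kappa> * of_real (exp (- \<mu> * s)))))
      \<longlongrightarrow> norm (c (Suc m))) at_top"
    by (rule tendsto_norm)
  moreover have "norm (of_real (exp (lam (Suc m) * s)) * (\<kappa> * of_real (exp (- \<mu> * s))))
      = norm \<kappa> * exp ((lam (Suc m) - \<mu>) * s)" for s
  proof -
    have "exp (lam (Suc m) * s) * exp (- \<mu> * s) = exp ((lam (Suc m) - \<mu>) * s)"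
      unfolding exp_add[symmetric] by (simp add: algebra_simps)
    then show ?thesis by (simp add: norm_mult mult.left_commute del: of_real_exp)
  qed
  ultimately have "((\<lambda>s. norm \<kappa> * exp ((lam (Suc m) - \<mu>) * s)) \<longlongrightarrow> norm (c (Suc m))) at_top"
    by simp
  then have "lam (Suc m) - \<mu> = 0"
    using m by (intro exp_rate_zero_of_nonzero_limit) auto
  then show ?thesis
    using m zero by (intro that[of "Suc m"]) (auto simp: gr0_conv_Suc Suc_le_eq)
qed

section \<open>Polynomial symbols of bounded composition operators\<close>

text \<open>The strict inequality \<open>Re (a s + b) > \<theta>\<close> at real \<open>s > \<theta>\<close> becomes a weak one as \<open>s\<close> tends to \<open>\<theta>\<close>.\<close>

lemma affine_self_map_half_plane_Re_ge:
  fixes a :: real and b :: complex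
  assumes "\<And>z. z \<in> half_plane \<theta> \<Longrightarrow> complex_of_real a * z + b \<in> half_plane \<theta>"
  shows "Re b \<ge> (1 - a) * \<theta>"
proof -
  have lim: "((\<lambda>s. a * s + Re b) \<longlongrightarrow> a * \<theta> + Re b) (at_right \<theta>)"
    by (intro tendsto_intros)
  have "eventually (\<lambda>s. \<theta> \<le> a * s + Re b) (at_right \<theta>)"
    using eventually_at_right_less[of \<theta>]
  proof eventually_elim
    case (elim s)
    then show ?case using assms[of "complex_of_real s"] by (simp add: half_plane_def)
  qed
  from tendsto_lowerbound[OF lim this] show ?thesis by (simp add: algebra_simps)
qed

theorem theorem3p5:
  fixes lam \<beta> :: "nat \<Rightarrow> real" and p :: "complex poly" and \<theta> :: real
  assumes lam_nonneg: "\<And>n. n \<ge> 1 \<Longrightarrow> lam n \<ge> 0"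
    and lam_strict: "strict_mono_on {1..} lam"
    and lam_lim: "filterlim lam at_top sequentially"
    and L_finite: "growth_exponent lam < \<infinity>"
    and beta_pos: "\<And>n. n \<ge> 1 \<Longrightarrow> \<beta> n > 0"
    and beta_star_finite: "weight_exponent \<beta> lam \<noteq> \<infinity>" "weight_exponent \<beta> lam \<noteq> -\<infinity>"
    and theta: "\<theta> = abscissa \<beta> lam"
    and self_map: "poly p ` half_plane \<theta> \<subseteq> half_plane \<theta>"
    and bounded: "bounded_comp_op \<beta> lam (poly p)"
  shows "\<exists>(a::real) (b::complex).
      (\<forall>z. poly p z = complex_of_real a * z + b) \<and>
      (lam 1 > 0 \<longrightarrow> a \<ge> 1) \<and>
      (lam 1 = 0 \<longrightarrow> a = 0 \<or> a \<ge> 1) \<and>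
      (\<forall>k\<ge>1. \<exists>m\<ge>1.
         (let c = dirichlet_coeff \<beta> lam
                    (comp_op (poly p) (\<lambda>z. exp (- complex_of_real (lam k) * z)))
          in c m \<noteq> 0 \<and> (\<forall>n. 1 \<le> n \<and> n < m \<longrightarrow> c n = 0)) \<and>
         lam m = a * lam k) \<and>
      (a = 0 \<longrightarrow> Re b > \<theta>) \<and>
      (a \<ge> 1 \<longrightarrow> Re b \<ge> (1 - a) * \<theta>)"
proof -
  obtain a b where "a \<ge> 0" and p: "\<And>z. poly p z = complex_of_real a * z + b"
    using poly_between_half_planes_affine[OF self_map] by blast
  have self: "complex_of_real a * z + b \<in> half_plane \<theta>" if "z \<in> half_plane \<theta>" for z
    using self_map that p by (metis image_subset_iff)
  define c where "c k = dirichlet_coeff \<beta> lam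
      (comp_op (poly p) (\<lambda>z. exp (- complex_of_real (lam k) * z)))" for k
  have freq: "\<exists>m\<ge>1. c k m \<noteq> 0 \<and> (\<forall>n. 1 \<le> n \<and> n < m \<longrightarrow> c k n = 0) \<and> lam m = a * lam k"
    if "k \<ge> 1" for k
  proof -
    have "comp_op (poly p) (\<lambda>z. exp (- complex_of_real (lam k) * z)) \<in> dirichlet_space \<beta> lam"
      using bounded exponential_in_dirichlet_space[OF that] by (simp add: bounded_comp_op_def)
    then have "dirichlet_rep \<beta> lam (comp_op (poly p) (\<lambda>z. exp (- complex_of_real (lam k) * z))) (c k)"
      unfolding c_def by (rule dirichlet_rep_dirichlet_coeff)
    moreover have "comp_op (poly p) (\<lambda>z. exp (- complex_of_real (lam k) * z))
        = (\<lambda>z. exp (- complex_of_real (lam k) * b) * exp (- complex_of_real (a * lam k) * z))"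
      by (auto simp: comp_op_def p algebra_simps simp flip: exp_add)
    ultimately have "dirichlet_rep \<beta> lam
        (\<lambda>z. exp (- complex_of_real (lam k) * b) * exp (- complex_of_real (a * lam k) * z)) (c k)"
      by simp
    from exponential_leading_exponent[OF lam_strict lam_lim L_finite this]
    show ?thesis by (metis exp_not_eq_zero)
  qed
  have mono: "lam i \<le> lam j" if "1 \<le> i" "i \<le> j" for i j
    using lam_strict that by (auto simp: strict_mono_on_def le_less)
  have lam2: "lam 1 < lam 2"
    using lam_strict by (simp add: strict_mono_on_def)
  have case1: "a \<ge> 1" if "lam 1 > 0"
  proof -
    obtain m where "m \<ge> 1" "lam m = a * lam 1" using freq[of 1] by auto
    then have "lam 1 \<le> a * lam 1" using mono[of 1 m] by simp
    then show ?thesis using that by simp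
  qed
  have case2: "a = 0 \<or> a \<ge> 1" if "lam 1 = 0"
  proof (rule disjCI)
    assume "\<not> a \<ge> 1"
    obtain m where m: "m \<ge> 1" "lam m = a * lam 2" using freq[of 2] by auto
    have "a * lam 2 < lam 2" using \<open>\<not> a \<ge> 1\<close> lam2 that by simp
    \<comment> \<open>The only frequency below \<open>\<lambda>\<^sub>2\<close> is \<open>\<lambda>\<^sub>1 = 0\<close>.\<close>
    then have "m = 1" using m mono[of 2 m] by (cases "m \<ge> 2") auto
    then have "a * lam 2 = 0" using m that by simp
    then show "a = 0" using lam2 that by auto
  qed
  have "Re b > \<theta>" if "a = 0"
    using self[of "complex_of_real (\<theta> + 1)"] that by (simp add: half_plane_def)
  moreover have "Re b \<ge> (1 - a) * \<theta>"
    using self by (rule affine_self_map_half_plane_Re_ge)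
  ultimately show ?thesis
    using p case1 case2 freq unfolding c_def Let_def by (intro exI[of _ a] exI[of _ b]) blast
qed

end
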